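(* Let $0\to\mathfrak{h}_Q\xrightarrow{i}\mathfrak{e}_U\xrightarrow{p}\mathfrak{g}_P\to0$ be a non-abelian extension of averaging Lie algebras, and fix any section $s$ of $p$ with corresponding non-abelian $2$-cocycle $(\chi,\psi,\Phi)$. A pair $(\beta,\alpha)\in\mathrm{Aut}(\mathfrak{h}_Q)\times\mathrm{Aut}(\mathfrak{g}_P)$ of averaging Lie algebra automorphisms is inducible if and only if $\mathcal{W}((\beta,\alpha))=0$, i.e. if and only if the non-abelian $2$-cocycles $(\chi_{(\beta,\alpha)},\psi_{(\beta,\alpha)},\Phi_{(\beta,\alpha)})$ and $(\chi,\psi,\Phi)$ are equivalent.
   Context: Everything is over a field of characteristic zero. An averaging operator on a Lie algebra $\mathfrak{g}$ is a linear map $P:\mathfrak{g}\to\mathfrak{g}$ with $[P(x),P(y)]_{\mathfrak{g}}=P([P(x),y]_{\mathfrak{g}})$ for all $x,y$; an averaging Lie algebra $\mathfrak{g}_P$ is a Lie algebra $\mathfrak{g}$ with an averaging operator $P$. A morphism $\mathfrak{g}_P\to\mathfrak{g}'_{P'}$ is a Lie algebra homomorphism $\tau$ with $P'\circ\tau=\tau\circ P$; $\mathrm{Aut}(\mathfrak{g}_P)$ is the group of bijective morphisms $\mathfrak{g}_P\to\mathfrak{g}_P$. A non-abelian extension of $\mathfrak{g}_P$ by $\mathfrak{h}_Q$ is an averaging Lie algebra $\mathfrak{e}_U$ with a short exact sequence $0\to\mathfrak{h}_Q\xrightarrow{i}\mathfrak{e}_U\xrightarrow{p}\mathfrak{g}_P\to0$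 of averaging Lie algebras ($i,p$ morphisms); $\mathfrak{h}$ is identified with $i(\mathfrak{h})\subset\mathfrak{e}$. A section is a linear map $s:\mathfrak{g}\to\mathfrak{e}$ with $p\circ s=\mathrm{Id}_{\mathfrak{g}}$. The corresponding non-abelian $2$-cocycle is the triple $\chi(x,y)=[s(x),s(y)]_{\mathfrak{e}}-s[x,y]_{\mathfrak{g}}$, $\psi_x(h)=[s(x),h]_{\mathfrak{e}}$, $\Phi(x)=U(s(x))-s(P(x))$. In general, a non-abelian $2$-cocycle of $\mathfrak{g}_P$ with values in $\mathfrak{h}_Q$ is a triple $(\chi,\psi,\Phi)$ of linear maps $\chi:\wedge^2\mathfrak{g}\to\mathfrak{h}$, $\psi:\mathfrak{g}\to\mathrm{Der}(\mathfrak{h})$, $\Phi:\mathfrak{g}\to\mathfrak{h}$ such that for all $x,y,z\in\mathfrak{g}$, $h\in\mathfrak{h}$: (a) $\psi_x\psi_y(h)-\psi_y\psi_x(h)-\psi_{[x,y]_{\mathfrak{g}}}(h)=[\chi(x,y),h]_{\mathfrak{h}}$; (b) $\psi_x\chi(y,z)+\psi_y\chi(z,x)+\psi_z\chi(x,y)-\chi([x,y]_{\mathfrak{g}},z)-\chi([y,z]_{\mathfrak{g}},x)-\chi([z,x]_{\mathfrak{g}},y)=0$; (c) $\psi_{P(x)}Q(h)=Q(\psi_{P(x)}h)+Q[\Phi(x),h]_{\mathfrak{h}}-[\Phi(x),Q(h)]_{\mathfrak{h}}=Q(\psi_xQ(h))-[\Phi(x),Q(h)]_{\mathfrak{h}}$;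 (d) $\chi(P(x),P(y))-Q(\chi(P(x),y))-\Phi[P(x),y]_{\mathfrak{g}}+\psi_{P(x)}\Phi(y)-\psi_{P(y)}\Phi(x)+Q(\psi_y\Phi(x))+[\Phi(x),\Phi(y)]_{\mathfrak{h}}=0$. Non-abelian $2$-cocycles $(\chi,\psi,\Phi)$ and $(\chi',\psi',\Phi')$ are equivalent if there is a linear map $\phi:\mathfrak{g}\to\mathfrak{h}$ such that for all $x,y\in\mathfrak{g}$, $h\in\mathfrak{h}$: $\psi_xh-\psi'_xh=[\phi(x),h]_{\mathfrak{h}}$; $\chi(x,y)-\chi'(x,y)=\psi'_x\phi(y)-\psi'_y\phi(x)-\phi[x,y]_{\mathfrak{g}}+[\phi(x),\phi(y)]_{\mathfrak{h}}$; $\Phi(x)-\Phi'(x)=Q\phi(x)-\phi P(x)$. $H^2_{\mathrm{nab}}(\mathfrak{g}_P,\mathfrak{h}_Q)$ is the set of equivalence classes. For $(\beta,\alpha)\in\mathrm{Aut}(\mathfrak{h}_Q)\times\mathrm{Aut}(\mathfrak{g}_P)$ the non-abelian $2$-cocycle $(\chi_{(\beta,\alpha)},\psi_{(\beta,\alpha)},\Phi_{(\beta,\alpha)})$ is defined by $\chi_{(\beta,\alpha)}(x,y)=\beta\chi(\alpha^{-1}(x),\alpha^{-1}(y))$, $(\psi_{(\beta,\alpha)})_xh=\beta(\psi_{\alpha^{-1}(x)}\beta^{-1}(h))$, $\Phi_{(\beta,\alpha)}(x)=\beta\Phi(\alpha^{-1}(x))$. The Wells map $\mathcal{W}$ is denoted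 $\mathcal{W}((\beta,\alpha))=[(\chi_{(\beta,\alpha)},\psi_{(\beta,\alpha)},\Phi_{(\beta,\alpha)})-(\chi,\psi,\Phi)]$; "$\mathcal{W}((\beta,\alpha))=0$" means that these two cocycles are equivalent. The pair $(\beta,\alpha)$ is inducible if there is an averaging Lie algebra automorphism $\gamma\in\mathrm{Aut}(\mathfrak{e}_U)$ with $\gamma(\mathfrak{h})\subset\mathfrak{h}$, $\gamma|_{\mathfrak{h}}=\beta$ and $\overline{\gamma}=\alpha$, where $\overline{\gamma}:=p\gamma s:\mathfrak{g}\to\mathfrak{g}$ (independent of the section $s$). *)

theory Defs
  imports Complex_Main
begin

text \<open>
  Vector spaces over a field \<open>'k\<close> of characteristic zero live on whole types, as in
  \<^theory>\<open>HOL.Vector_Spaces\<close>; the record only collects the scalar multiplication, the Lie bracket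
  and the averaging operator, so that the maps below need not mention three arguments per algebra.
\<close>

record ('k, 'a) avg_lie =
  smul :: "'k \<Rightarrow> 'a \<Rightarrow> 'a"
  brk :: "'a \<Rightarrow> 'a \<Rightarrow> 'a"
  avg :: "'a \<Rightarrow> 'a"

definition bilinear_map ::
  "('k::field \<Rightarrow> 'a::ab_group_add \<Rightarrow> 'a) \<Rightarrow> ('k \<Rightarrow> 'b::ab_group_add \<Rightarrow> 'b) \<Rightarrow> ('a \<Rightarrow> 'a \<Rightarrow> 'b) \<Rightarrow> bool"
  where "bilinear_map s1 s2 f \<longleftrightarrow>
    (\<forall>x. Vector_Spaces.linear s1 s2 (\<lambda>y. f x y)) \<and>
    (\<forall>y. Vector_Spaces.linear s1 s2 (\<lambda>x. f x y))"

locale lie_algebra = vector_space scale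
  for scale :: "'k::field_char_0 \<Rightarrow> 'a::ab_group_add \<Rightarrow> 'a" +
  fixes bracket :: "'a \<Rightarrow> 'a \<Rightarrow> 'a"
  assumes bracket_bilinear: "bilinear_map scale scale bracket"
    and bracket_alternating: "bracket x x = 0"
    and jacobi: "bracket x (bracket y z) + bracket y (bracket z x) + bracket z (bracket x y) = 0"

definition averaging_operator ::
  "('k::field_char_0 \<Rightarrow> 'a::ab_group_add \<Rightarrow> 'a) \<Rightarrow> ('a \<Rightarrow> 'a \<Rightarrow> 'a) \<Rightarrow> ('a \<Rightarrow> 'a) \<Rightarrow> bool"
  where "averaging_operator scale bracket P \<longleftrightarrow>
    Vector_Spaces.linear scale scale P \<and>
    (\<forall>x y. bracket (P x) (P y) = P (bracket (P x) y))"

definition averaging_lie_algebra :: "('k::field_char_0, 'a::ab_group_add) avg_lie \<Rightarrow> bool"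
  where "averaging_lie_algebra L \<longleftrightarrow>
    lie_algebra (smul L) (brk L) \<and> averaging_operator (smul L) (brk L) (avg L)"

definition averaging_morphism ::
  "('k::field_char_0, 'a::ab_group_add) avg_lie \<Rightarrow> ('k, 'b::ab_group_add) avg_lie \<Rightarrow> ('a \<Rightarrow> 'b) \<Rightarrow> bool"
  where "averaging_morphism L M f \<longleftrightarrow>
    Vector_Spaces.linear (smul L) (smul M) f \<and>
    (\<forall>x y. f (brk L x y) = brk M (f x) (f y)) \<and>
    avg M \<circ> f = f \<circ> avg L"

definition averaging_aut :: "('k::field_char_0, 'a::ab_group_add) avg_lie \<Rightarrow> ('a \<Rightarrow> 'a) set"
  where "averaging_aut L = {f. averaging_morphism L L f \<and> bij f}"

definition nonabelian_extension ::
  "('k::field_char_0, 'h::ab_group_add) avg_lie \<Rightarrow> ('k, 'e::ab_group_add) avg_lie \<Rightarrow>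
   ('k, 'g::ab_group_add) avg_lie \<Rightarrow> ('h \<Rightarrow> 'e) \<Rightarrow> ('e \<Rightarrow> 'g) \<Rightarrow> bool"
  where "nonabelian_extension H E G i p \<longleftrightarrow>
    averaging_lie_algebra H \<and> averaging_lie_algebra E \<and> averaging_lie_algebra G \<and>
    averaging_morphism H E i \<and> averaging_morphism E G p \<and>
    inj i \<and> range i = {e. p e = 0} \<and> surj p"

definition is_section ::
  "('k::field_char_0, 'e::ab_group_add) avg_lie \<Rightarrow> ('k, 'g::ab_group_add) avg_lie \<Rightarrow>
   ('e \<Rightarrow> 'g) \<Rightarrow> ('g \<Rightarrow> 'e) \<Rightarrow> bool"
  where "is_section E G p s \<longleftrightarrow> Vector_Spaces.linear (smul G) (smul E) s \<and> p \<circ> s = id"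

definition derivation :: "('k::field_char_0, 'a::ab_group_add) avg_lie \<Rightarrow> ('a \<Rightarrow> 'a) \<Rightarrow> bool"
  where "derivation L d \<longleftrightarrow>
    Vector_Spaces.linear (smul L) (smul L) d \<and>
    (\<forall>x y. d (brk L x y) = brk L (d x) y + brk L x (d y))"

text \<open>Candidate cocycles \<open>(\<chi>, \<psi>, \<Phi>)\<close>, with \<open>\<psi> x h\<close> for \<open>\<psi>\<close> at \<open>x\<close> applied to \<open>h\<close>.\<close>

type_synonym ('g, 'h) triple = "('g \<Rightarrow> 'g \<Rightarrow> 'h) \<times> ('g \<Rightarrow> 'h \<Rightarrow> 'h) \<times> ('g \<Rightarrow> 'h)"

text \<open>
  A linear map on the exterior square is an alternating bilinear map. Linearity of
  \<open>\<psi>\<close> as a map into derivations is linearity of \<open>x \<mapsto> \<psi> x h\<close> for every \<open>h\<close>.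
\<close>

definition nonabelian_2cocycle ::
  "('k::field_char_0, 'g::ab_group_add) avg_lie \<Rightarrow> ('k, 'h::ab_group_add) avg_lie \<Rightarrow>
   ('g, 'h) triple \<Rightarrow> bool"
  where "nonabelian_2cocycle G H = (\<lambda>(\<chi>, \<psi>, \<Phi>).
    (let P = avg G; Q = avg H in
      bilinear_map (smul G) (smul H) \<chi> \<and> (\<forall>x. \<chi> x x = 0) \<and>
      (\<forall>x. derivation H (\<psi> x)) \<and> (\<forall>h. Vector_Spaces.linear (smul G) (smul H) (\<lambda>x. \<psi> x h)) \<and>
      Vector_Spaces.linear (smul G) (smul H) \<Phi> \<and>
      (\<forall>x y h. \<psi> x (\<psi> y h) - \<psi> y (\<psi> x h) - \<psi> (brk G x y) h = brk H (\<chi> x y) h) \<and>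
      (\<forall>x y z. \<psi> x (\<chi> y z) + \<psi> y (\<chi> z x) + \<psi> z (\<chi> x y)
        - \<chi> (brk G x y) z - \<chi> (brk G y z) x - \<chi> (brk G z x) y = 0) \<and>
      (\<forall>x h. \<psi> (P x) (Q h) = Q (\<psi> (P x) h) + Q (brk H (\<Phi> x) h) - brk H (\<Phi> x) (Q h)) \<and>
      (\<forall>x h. \<psi> (P x) (Q h) = Q (\<psi> x (Q h)) - brk H (\<Phi> x) (Q h)) \<and>
      (\<forall>x y. \<chi> (P x) (P y) - Q (\<chi> (P x) y) - \<Phi> (brk G (P x) y)
        + \<psi> (P x) (\<Phi> y) - \<psi> (P y) (\<Phi> x) + Q (\<psi> y (\<Phi> x)) + brk H (\<Phi> x) (\<Phi> y) = 0)))"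

definition cocycle_equivalent ::
  "('k::field_char_0, 'g::ab_group_add) avg_lie \<Rightarrow> ('k, 'h::ab_group_add) avg_lie \<Rightarrow>
   ('g, 'h) triple \<Rightarrow> ('g, 'h) triple \<Rightarrow> bool"
  where "cocycle_equivalent G H c c' \<longleftrightarrow>
    nonabelian_2cocycle G H c \<and> nonabelian_2cocycle G H c' \<and>
    (case (c, c') of ((\<chi>, \<psi>, \<Phi>), (\<chi>', \<psi>', \<Phi>')) \<Rightarrow>
      \<exists>\<phi>. Vector_Spaces.linear (smul G) (smul H) \<phi> \<and>
        (\<forall>x h. \<psi> x h - \<psi>' x h = brk H (\<phi> x) h) \<and>
        (\<forall>x y. \<chi> x y - \<chi>' x y =
          \<psi>' x (\<phi> y) - \<psi>' y (\<phi> x) - \<phi> (brk G x y) + brk H (\<phi> x) (\<phi> y)) \<and>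
        (\<forall>x. \<Phi> x - \<Phi>' x = avg H (\<phi> x) - \<phi> (avg G x)))"

text \<open>
  The identification of \<open>H\<close> with its image under \<open>i\<close> is made explicit: the values below,
  which for an extension and a section lie in \<open>range i\<close>, are pulled back by \<open>inv i\<close>.
\<close>

definition section_cocycle ::
  "('k::field_char_0, 'e::ab_group_add) avg_lie \<Rightarrow> ('k, 'g::ab_group_add) avg_lie \<Rightarrow>
   ('h::ab_group_add \<Rightarrow> 'e) \<Rightarrow> ('g \<Rightarrow> 'e) \<Rightarrow> ('g, 'h) triple"
  where "section_cocycle E G i s =
    (\<lambda>x y. inv i (brk E (s x) (s y) - s (brk G x y)),
     \<lambda>x h. inv i (brk E (s x) (i h)),
     \<lambda>x. inv i (avg E (s x) - s (avg G x)))"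

definition twisted_cocycle ::
  "('h \<Rightarrow> 'h) \<Rightarrow> ('g \<Rightarrow> 'g) \<Rightarrow> ('g, 'h) triple \<Rightarrow> ('g, 'h) triple"
  where "twisted_cocycle \<beta> \<alpha> = (\<lambda>(\<chi>, \<psi>, \<Phi>).
    (\<lambda>x y. \<beta> (\<chi> (inv \<alpha> x) (inv \<alpha> y)),
     \<lambda>x h. \<beta> (\<psi> (inv \<alpha> x) (inv \<beta> h)),
     \<lambda>x. \<beta> (\<Phi> (inv \<alpha> x))))"

text \<open>
  For \<open>\<gamma>\<close> preserving \<open>range i\<close>, the map \<open>p \<circ> \<gamma> \<circ> s\<close> does not depend on the section \<open>s\<close>,
  and sections exist since these are vector spaces; hence quantifying over
  all sections is the same as choosing one, and keeps inducibility independent of a choice.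
\<close>

definition inducible ::
  "('k::field_char_0, 'e::ab_group_add) avg_lie \<Rightarrow> ('k, 'g::ab_group_add) avg_lie \<Rightarrow>
   ('h::ab_group_add \<Rightarrow> 'e) \<Rightarrow> ('e \<Rightarrow> 'g) \<Rightarrow> ('h \<Rightarrow> 'h) \<Rightarrow> ('g \<Rightarrow> 'g) \<Rightarrow> bool"
  where "inducible E G i p \<beta> \<alpha> \<longleftrightarrow>
    (\<exists>\<gamma> \<in> averaging_aut E.
      \<gamma> ` range i \<subseteq> range i \<and>
      (\<forall>h. \<gamma> (i h) = i (\<beta> h)) \<and>
      (\<forall>s. is_section E G p s \<longrightarrow> p \<circ> \<gamma> \<circ> s = \<alpha>))"

end

theory Submission
  imports Defs
begin

text \<open>
  Inducibility is an instance of the classification of extensions by non-abelian cocycles.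

  Automorphisms \<open>\<beta>\<close> of \<open>H\<close> and \<open>\<alpha>\<close> of \<open>G\<close> turn the extension with maps \<open>i\<close> and \<open>p\<close> into another
  extension with the same middle term \<open>E\<close>: the embedding becomes \<open>i \<circ> inv \<beta>\<close>, the projection
  becomes \<open>\<alpha> \<circ> p\<close>, and \<open>s \<circ> inv \<alpha>\<close> is a section of the latter. The cocycle of this relabelled
  extension is precisely the twist of the original cocycle by \<open>(\<beta>, \<alpha>)\<close>
  (\<open>section_cocycle_relabel\<close>). On the other hand, \<open>\<gamma>\<close> restricts to \<open>\<beta>\<close> and induces \<open>\<alpha>\<close>
  exactly when \<open>\<gamma> \<circ> (i \<circ> inv \<beta>) = i\<close> and \<open>p \<circ> \<gamma> = \<alpha> \<circ> p\<close>, that is, when \<open>\<gamma>\<close> is a morphism from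
  the relabelled extension to the original one that is the identity on both ends
  (\<open>inducible_iff_extension_morphism\<close>).

  It remains to see that two extensions with chosen sections admit such a morphism if and
  only if their cocycles are equivalent (\<open>extension_morphism_iff_cocycle_equivalent\<close>). A section
  identifies the middle term with \<open>G \<times> H\<close> by writing each element as \<open>s x + i h\<close>, and the cocycle
  is what is needed to express bracket and averaging operator in these coordinates. A
  morphism between two extensions has to be \<open>s x + i h \<mapsto> s' x + i' (\<phi> x + h)\<close> for a linear \<open>\<phi>\<close>,
  and comparing coordinates, it respects bracket and operator if and only if \<open>\<phi>\<close> is an
  equivalence of the cocycles. Such a morphism is bijective by the short five lemma.

  Equivalence includes that both triples are cocycles. This is \<open>section_cocycle_is_cocycle\<close>,
  which by the relabelling covers the twisted triple too.
\<close>

section \<open>Averaging Lie algebras and their morphisms\<close>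

lemma linear_iff_add_scale:
  "Vector_Spaces.linear s1 s2 f \<longleftrightarrow>
    vector_space s1 \<and> vector_space s2 \<and> (\<forall>x y. f (x + y) = f x + f y) \<and>
    (\<forall>c x. f (s1 c x) = s2 c (f x))"
  unfolding Vector_Spaces.linear_def module_hom_def module_hom_axioms_def
  by (auto simp: vector_space_def module_def)

lemma linear_map_simps:
  assumes "Vector_Spaces.linear s1 s2 f"
  shows "f (x + y) = f x + f y" "f (s1 c x) = s2 c (f x)" "f 0 = 0" "f (- x) = - f x"
    "f (x - y) = f x - f y"
proof -
  interpret Vector_Spaces.linear s1 s2 f by fact
  show "f (x + y) = f x + f y" "f (s1 c x) = s2 c (f x)" "f 0 = 0" "f (- x) = - f x"
    "f (x - y) = f x - f y"
    by (simp_all add: add scale neg diff)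
qed

locale averaging_lie =
  fixes L :: "('k::field_char_0, 'a::ab_group_add) avg_lie"
  assumes averaging_lie_algebra: "averaging_lie_algebra L"
begin

sublocale lie_algebra "smul L" "brk L"
  using averaging_lie_algebra by (simp add: averaging_lie_algebra_def)

lemma vs: "vector_space (smul L)" ..

lemma linear_brk:
  "Vector_Spaces.linear (smul L) (smul L) (\<lambda>y. brk L x y)"
  "Vector_Spaces.linear (smul L) (smul L) (\<lambda>x. brk L x y)"
  using bracket_bilinear by (auto simp: bilinear_map_def)

lemmas brk_simps = linear_map_simps[OF linear_brk(1)] linear_map_simps[OF linear_brk(2)]

lemma linear_avg: "Vector_Spaces.linear (smul L) (smul L) (avg L)"
  using averaging_lie_algebra by (simp add: averaging_lie_algebra_def averaging_operator_def)

lemmas avg_simps = linear_map_simps[OF linear_avg]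

lemma brk_anticommute: "brk L x y = - brk L y x"
proof -
  have "brk L (x + y) (x + y) = brk L x x + brk L y y + (brk L x y + brk L y x)"
    by (simp add: brk_simps)
  then have "brk L x y + brk L y x = 0"
    by (simp add: bracket_alternating)
  then show ?thesis by (simp add: eq_neg_iff_add_eq_0)
qed

lemma brk_leibniz: "brk L x (brk L y z) = brk L (brk L x y) z + brk L y (brk L x z)"
  using jacobi[of x y z] brk_anticommute[of z x] brk_anticommute[of z "brk L x y"]
  by (simp add: brk_simps algebra_simps)

lemma avg_left: "brk L (avg L x) (avg L y) = avg L (brk L (avg L x) y)"
  using averaging_lie_algebra by (simp add: averaging_lie_algebra_def averaging_operator_def)

text \<open>The averaging identity treats both arguments alike, because the bracket anticommutes.\<close>

lemma avg_right: "brk L (avg L x) (avg L y) = avg L (brk L x (avg L y))"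
  using avg_left[of y x] brk_anticommute[of "avg L x" "avg L y"] brk_anticommute[of "avg L y" x]
  by (simp add: avg_simps)

end

lemma averaging_morphism_linear:
  "averaging_morphism L M f \<Longrightarrow> Vector_Spaces.linear (smul L) (smul M) f"
  by (simp add: averaging_morphism_def)

lemma averaging_morphism_simps:
  assumes "averaging_morphism L M f"
  shows "f (x + y) = f x + f y" "f (smul L c x) = smul M c (f x)" "f 0 = 0" "f (- x) = - f x"
    "f (x - y) = f x - f y" "f (brk L x y) = brk M (f x) (f y)" "f (avg L x) = avg M (f x)"
  using assms linear_map_simps[OF averaging_morphism_linear[OF assms]]
  by (auto simp: averaging_morphism_def fun_eq_iff)

lemma averaging_morphism_compose:
  assumes "averaging_morphism L M f" "averaging_morphism M N g"
  shows "averaging_morphism L N (g \<circ> f)"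
  using assms Vector_Spaces.linear_compose[of "smul L" "smul M" f "smul N" g]
  by (auto simp: averaging_morphism_def fun_eq_iff)

lemma averaging_aut_inv:
  assumes "f \<in> averaging_aut L"
  shows "averaging_morphism L L (inv f)"
proof -
  have f: "averaging_morphism L L f" "bij f" using assms by (auto simp: averaging_aut_def)
  note s = averaging_morphism_simps[OF f(1)] bij_is_inj[OF f(2)] bij_is_surj[OF f(2)]
  have inv_eqI: "inv f x = y" if "f y = x" for x y
    using that s by (auto simp: inv_f_eq)
  show ?thesis
    using averaging_morphism_linear[OF f(1)]
    by (auto simp: averaging_morphism_def linear_iff_add_scale fun_eq_iff s surj_f_inv_f
      intro!: inv_eqI inv_eqI[symmetric])
qed

section \<open>Extensions in the coordinates of a section\<close>

locale sectioned_extension =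
  fixes H :: "('k::field_char_0, 'h::ab_group_add) avg_lie"
    and E :: "('k, 'e::ab_group_add) avg_lie"
    and G :: "('k, 'g::ab_group_add) avg_lie"
    and i :: "'h \<Rightarrow> 'e" and p :: "'e \<Rightarrow> 'g" and s :: "'g \<Rightarrow> 'e"
  assumes extension: "nonabelian_extension H E G i p"
    and "section": "is_section E G p s"
begin

sublocale H: averaging_lie H
  using extension by unfold_locales (simp add: nonabelian_extension_def)
sublocale E: averaging_lie E
  using extension by unfold_locales (simp add: nonabelian_extension_def)
sublocale G: averaging_lie G
  using extension by unfold_locales (simp add: nonabelian_extension_def)

lemma i_morphism: "averaging_morphism H E i" and p_morphism: "averaging_morphism E G p"
  and inj_i: "inj i" and range_i: "range i = {e. p e = 0}" and surj_p: "surj p"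
  using extension by (auto simp: nonabelian_extension_def)

lemma s_linear: "Vector_Spaces.linear (smul G) (smul E) s" and p_s [simp]: "p (s x) = x"
  using "section" by (auto simp: is_section_def fun_eq_iff)

lemmas i_simps = averaging_morphism_simps[OF i_morphism]
lemmas p_simps = averaging_morphism_simps[OF p_morphism]
lemmas s_simps = linear_map_simps[OF s_linear]

lemma p_i [simp]: "p (i h) = 0"
  using range_i by auto

lemma i_eq_iff [simp]: "i a = i b \<longleftrightarrow> a = b"
  using inj_i by (auto dest: injD)

lemma i_inv: "p e = 0 \<Longrightarrow> i (inv i e) = e"
  using range_i by (auto intro: f_inv_into_f)

definition \<chi> :: "'g \<Rightarrow> 'g \<Rightarrow> 'h" where "\<chi> = fst (section_cocycle E G i s)"
definition \<psi> :: "'g \<Rightarrow> 'h \<Rightarrow> 'h" where "\<psi> = fst (snd (section_cocycle E G i s))"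
definition \<Phi> :: "'g \<Rightarrow> 'h" where "\<Phi> = snd (snd (section_cocycle E G i s))"

lemma section_cocycle_eq: "section_cocycle E G i s = (\<chi>, \<psi>, \<Phi>)"
  by (simp add: \<chi>_def \<psi>_def \<Phi>_def)

lemma i_\<chi>: "i (\<chi> x y) = brk E (s x) (s y) - s (brk G x y)"
  and i_\<psi>: "i (\<psi> x h) = brk E (s x) (i h)"
  and i_\<Phi>: "i (\<Phi> x) = avg E (s x) - s (avg G x)"
  by (simp_all add: \<chi>_def \<psi>_def \<Phi>_def section_cocycle_def i_inv p_simps G.brk_simps)

lemma coordinates: obtains x h where "e = s x + i h"
proof
  show "e = s (p e) + i (inv i (e - s (p e)))"
    by (simp add: i_inv p_simps)
qed

lemma coordinates_eq_iff: "s x + i h = s y + i k \<longleftrightarrow> x = y \<and> h = k"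
proof
  assume eq: "s x + i h = s y + i k"
  from arg_cong[OF eq, of p] have "x = y" by (simp add: p_simps)
  with eq show "x = y \<and> h = k" by simp
qed simp

text \<open>
  The cocycle and the operations of \<open>G\<close> and \<open>H\<close> determine \<open>E\<close>: in the coordinates \<open>(x, h)\<close> of
  \<open>s x + i h\<close>, they are all that enters the bracket and the averaging operator.
\<close>

lemma brk_coordinates:
  "brk E (s x + i h) (s y + i k) =
    s (brk G x y) + i (\<chi> x y + \<psi> x k - \<psi> y h + brk H h k)"
  using E.brk_anticommute[of "i h" "s y"]
  by (simp add: i_simps i_\<chi> i_\<psi> E.brk_simps)

lemma avg_coordinates: "avg E (s x + i h) = s (avg G x) + i (\<Phi> x + avg H h)"
  by (simp add: i_simps i_\<Phi> E.avg_simps)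

text \<open>
  As \<open>i\<close> is injective, the cocycle identities can be checked in \<open>E\<close>. Those without an averaging
  operator are the Jacobi identity of \<open>E\<close>: at \<open>(s x, i h, i k)\<close> it makes \<open>\<psi> x\<close> a derivation, at
  \<open>(s x, s y, i h)\<close> it computes the commutator of \<open>\<psi> x\<close> and \<open>\<psi> y\<close>, at \<open>(s x, s y, s z)\<close> it gives the
  cyclic identity for \<open>\<chi>\<close>. The others are the averaging identity of \<open>E\<close>, at \<open>(s x, i h)\<close> for
  \<open>\<psi>\<close> and at \<open>(s x, s y)\<close> for \<open>\<Phi>\<close>, where \<open>s (avg G x)\<close> and \<open>avg E (s x)\<close> differ by \<open>i (\<Phi> x)\<close>.
\<close>

lemma section_cocycle_is_cocycle: "nonabelian_2cocycle G H (section_cocycle E G i s)"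
proof -
  have linear_\<psi>: "Vector_Spaces.linear (smul H) (smul H) (\<psi> x)"
    "Vector_Spaces.linear (smul G) (smul H) (\<lambda>x. \<psi> x h)" for x h
    by (auto simp: linear_iff_add_scale H.vs G.vs i_eq_iff[symmetric] i_simps i_\<psi> E.brk_simps
      s_simps simp del: i_eq_iff)
  have derivation: "derivation H (\<psi> x)" for x
    using E.brk_leibniz[of "s x"]
    by (auto simp: derivation_def linear_\<psi> i_eq_iff[symmetric] i_simps i_\<psi> simp del: i_eq_iff)
  have bilinear_\<chi>: "bilinear_map (smul G) (smul H) \<chi>"
    by (auto simp: bilinear_map_def linear_iff_add_scale H.vs G.vs i_eq_iff[symmetric] i_simps i_\<chi>
      E.brk_simps G.brk_simps s_simps E.scale_right_diff_distrib simp del: i_eq_iff)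
  have linear_\<Phi>: "Vector_Spaces.linear (smul G) (smul H) \<Phi>"
    by (auto simp: linear_iff_add_scale H.vs G.vs i_eq_iff[symmetric] i_simps i_\<Phi> E.avg_simps
      G.avg_simps s_simps E.scale_right_diff_distrib simp del: i_eq_iff)
  have alternating: "\<chi> x x = 0" for x
    by (simp add: i_eq_iff[symmetric] i_simps i_\<chi> E.bracket_alternating G.bracket_alternating
      s_simps del: i_eq_iff)
  have a: "\<psi> x (\<psi> y h) - \<psi> y (\<psi> x h) - \<psi> (brk G x y) h = brk H (\<chi> x y) h" for x y h
    using E.brk_leibniz[of "s x" "s y" "i h"]
    by (simp add: i_eq_iff[symmetric] i_simps i_\<chi> i_\<psi> E.brk_simps del: i_eq_iff)
  have b: "\<psi> x (\<chi> y z) + \<psi> y (\<chi> z x) + \<psi> z (\<chi> x y)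
        - \<chi> (brk G x y) z - \<chi> (brk G y z) x - \<chi> (brk G z x) y = 0" for x y z
  proof -
    \<comment> \<open>Each \<open>\<psi>\<close> term is paired with the \<open>\<chi>\<close> term that cancels its mixed bracket of
      \<open>s x\<close> with \<open>s (brk G y z)\<close>; what is left are the Jacobi sums of \<open>E\<close> and of \<open>G\<close>.\<close>
    have swap: "i (\<psi> x (\<chi> y z)) - i (\<chi> (brk G y z) x) =
        brk E (s x) (brk E (s y) (s z)) - s (brk G x (brk G y z))" for x y z
      using E.brk_anticommute[of "s (brk G y z)" "s x"] G.brk_anticommute[of "brk G y z" x]
      by (simp add: i_\<psi> i_\<chi> E.brk_simps s_simps)
    have "i (\<psi> x (\<chi> y z) + \<psi> y (\<chi> z x) + \<psi> z (\<chi> x y)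
        - \<chi> (brk G x y) z - \<chi> (brk G y z) x - \<chi> (brk G z x) y) =
      (i (\<psi> x (\<chi> y z)) - i (\<chi> (brk G y z) x)) + (i (\<psi> y (\<chi> z x)) - i (\<chi> (brk G z x) y))
        + (i (\<psi> z (\<chi> x y)) - i (\<chi> (brk G x y) z))"
      by (simp add: i_simps)
    also have "\<dots> =
        (brk E (s x) (brk E (s y) (s z)) + brk E (s y) (brk E (s z) (s x))
          + brk E (s z) (brk E (s x) (s y)))
        - s (brk G x (brk G y z) + brk G y (brk G z x) + brk G z (brk G x y))"
      by (simp add: swap s_simps)
    also have "\<dots> = i 0" by (simp add: E.jacobi G.jacobi s_simps i_simps)
    finally show ?thesis by simp
  qed
  have s_P: "s (avg G x) = avg E (s x) - i (\<Phi> x)" for x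
    by (simp add: i_\<Phi>)
  have c1: "\<psi> (avg G x) (avg H h) =
      avg H (\<psi> (avg G x) h) + avg H (brk H (\<Phi> x) h) - brk H (\<Phi> x) (avg H h)" for x h
    using E.avg_left[of "s x" "i h"]
    by (simp add: i_eq_iff[symmetric] i_simps i_\<psi> s_P E.brk_simps E.avg_simps del: i_eq_iff)
  have c2: "\<psi> (avg G x) (avg H h) = avg H (\<psi> x (avg H h)) - brk H (\<Phi> x) (avg H h)" for x h
    using E.avg_right[of "s x" "i h"]
    by (simp add: i_eq_iff[symmetric] i_simps i_\<psi> s_P E.brk_simps del: i_eq_iff)
  have d: "\<chi> (avg G x) (avg G y) - avg H (\<chi> (avg G x) y) - \<Phi> (brk G (avg G x) y)
        + \<psi> (avg G x) (\<Phi> y) - \<psi> (avg G y) (\<Phi> x) + avg H (\<psi> y (\<Phi> x)) + brk H (\<Phi> x) (\<Phi> y) = 0"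
    for x y
  proof -
    \<comment> \<open>The averaging identity at \<open>(s x, s y)\<close>, with both sides computed in coordinates.\<close>
    have U: "avg E (s z) = s (avg G z) + i (\<Phi> z)" for z by (simp add: i_\<Phi>)
    have "brk E (avg E (s x)) (avg E (s y)) = s (brk G (avg G x) (avg G y)) +
        i (\<chi> (avg G x) (avg G y) + \<psi> (avg G x) (\<Phi> y) - \<psi> (avg G y) (\<Phi> x) + brk H (\<Phi> x) (\<Phi> y))"
      by (simp add: U brk_coordinates)
    moreover have "avg E (brk E (avg E (s x)) (s y)) = s (avg G (brk G (avg G x) y)) +
        i (\<Phi> (brk G (avg G x) y) + avg H (\<chi> (avg G x) y - \<psi> y (\<Phi> x)))"
    proof -
      have "brk E (avg E (s x)) (s y) = s (brk G (avg G x) y) + i (\<chi> (avg G x) y - \<psi> y (\<Phi> x))"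
        using brk_coordinates[of "avg G x" "\<Phi> x" y 0]
        by (simp add: U i_simps(3) H.brk_simps linear_map_simps[OF linear_\<psi>(1)])
      then show ?thesis by (simp only: avg_coordinates)
    qed
    ultimately show ?thesis
      using E.avg_left[of "s x" "s y"] by (simp add: coordinates_eq_iff H.avg_simps algebra_simps)
  qed
  show ?thesis
    unfolding section_cocycle_eq nonabelian_2cocycle_def Let_def prod.case
    using bilinear_\<chi> alternating derivation linear_\<psi>(2) linear_\<Phi> a b c1 c2 d by blast
qed

end

section \<open>Equivalent cocycles classify isomorphic extensions\<close>

definition extension_morphism ::
  "('k::field_char_0, 'e::ab_group_add) avg_lie \<Rightarrow> ('h \<Rightarrow> 'e) \<Rightarrow> ('e \<Rightarrow> 'g) \<Rightarrow>
   ('k, 'f::ab_group_add) avg_lie \<Rightarrow> ('h \<Rightarrow> 'f) \<Rightarrow> ('f \<Rightarrow> 'g) \<Rightarrow> ('e \<Rightarrow> 'f) \<Rightarrow> bool"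
  where "extension_morphism E i p F j q \<gamma> \<longleftrightarrow>
    averaging_morphism E F \<gamma> \<and> \<gamma> \<circ> i = j \<and> q \<circ> \<gamma> = p"

locale two_sectioned_extensions =
  A: sectioned_extension H E G i p s + B: sectioned_extension H F G j q t
  for H :: "('k::field_char_0, 'h::ab_group_add) avg_lie"
    and E :: "('k, 'e::ab_group_add) avg_lie" and F :: "('k, 'f::ab_group_add) avg_lie"
    and G :: "('k, 'g::ab_group_add) avg_lie"
    and i :: "'h \<Rightarrow> 'e" and p :: "'e \<Rightarrow> 'g" and s :: "'g \<Rightarrow> 'e"
    and j :: "'h \<Rightarrow> 'f" and q :: "'f \<Rightarrow> 'g" and t :: "'g \<Rightarrow> 'f"
begin

text \<open>
  The short five lemma, with the identity at both ends: the kernel of \<open>\<gamma>\<close> lies in \<open>range i\<close>, where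
  \<open>\<gamma>\<close> is injective, and every element differs from one in \<open>range \<gamma>\<close> by an element of \<open>range j\<close>.
\<close>

lemma extension_morphism_bij:
  assumes "extension_morphism E i p F j q \<gamma>"
  shows "bij \<gamma>"
proof -
  have \<gamma>: "averaging_morphism E F \<gamma>" "\<gamma> (i h) = j h" "q (\<gamma> e) = p e" for h e
    using assms by (auto simp: extension_morphism_def fun_eq_iff)
  note \<gamma>_simps = averaging_morphism_simps[OF \<gamma>(1)]
  have "inj \<gamma>"
  proof (rule injI)
    fix a b assume eq: "\<gamma> a = \<gamma> b"
    then have "p (a - b) = 0" using \<gamma>(3)[of a] \<gamma>(3)[of b] by (simp add: A.p_simps)
    then obtain h where h: "a - b = i h" using A.range_i by auto
    then have "j h = j 0" using eq \<gamma>(2)[of h] \<gamma>_simps(5)[of a b] by (simp add: B.i_simps)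
    then show "a = b" using h by (simp add: A.i_simps)
  qed
  moreover have "f \<in> range \<gamma>" for f
  proof -
    have "q (f - \<gamma> (s (q f))) = 0" by (simp add: B.p_simps \<gamma>)
    then obtain h where "f - \<gamma> (s (q f)) = j h" using B.range_i by auto
    then have "f = \<gamma> (s (q f) + i h)" by (simp add: \<gamma>_simps \<gamma>(2) algebra_simps)
    then show ?thesis by blast
  qed
  ultimately show ?thesis by (auto simp: bij_def)
qed

text \<open>
  The equivalence \<open>\<phi>\<close> measures the failure of \<open>\<gamma>\<close> to carry the section \<open>s\<close> to the section \<open>t\<close>.
\<close>

lemma cocycle_equivalent_if_extension_morphism:
  assumes "extension_morphism E i p F j q \<gamma>"
  shows "cocycle_equivalent G H (section_cocycle E G i s) (section_cocycle F G j t)"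
proof -
  have \<gamma>: "averaging_morphism E F \<gamma>" "\<gamma> (i h) = j h" "q (\<gamma> e) = p e" for h e
    using assms by (auto simp: extension_morphism_def fun_eq_iff)
  note \<gamma>_simps = averaging_morphism_simps[OF \<gamma>(1)]
  define \<phi> where "\<phi> x = inv j (\<gamma> (s x) - t x)" for x
  have j_\<phi>: "j (\<phi> x) = \<gamma> (s x) - t x" for x
    by (simp add: \<phi>_def B.i_inv B.p_simps \<gamma>)
  have \<gamma>_s: "\<gamma> (s x) = t x + j (\<phi> x)" for x by (simp add: j_\<phi>)
  have "Vector_Spaces.linear (smul G) (smul H) \<phi>"
    by (auto simp: linear_iff_add_scale A.G.vs A.H.vs B.i_eq_iff[symmetric] B.i_simps j_\<phi> \<gamma>_simps
      A.s_simps B.s_simps B.E.scale_right_diff_distrib simp del: B.i_eq_iff)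
  moreover have "A.\<psi> x h - B.\<psi> x h = brk H (\<phi> x) h" for x h
    using arg_cong[OF A.i_\<psi>, of \<gamma> x h]
    by (simp add: B.i_eq_iff[symmetric] B.i_simps B.i_\<psi> \<gamma> \<gamma>_simps \<gamma>_s B.E.brk_simps
      del: B.i_eq_iff)
  moreover have "A.\<chi> x y - B.\<chi> x y =
      B.\<psi> x (\<phi> y) - B.\<psi> y (\<phi> x) - \<phi> (brk G x y) + brk H (\<phi> x) (\<phi> y)" for x y
  proof -
    have "j (A.\<chi> x y) = brk F (t x + j (\<phi> x)) (t y + j (\<phi> y)) - (t (brk G x y) + j (\<phi> (brk G x y)))"
      using arg_cong[OF A.i_\<chi>, of \<gamma> x y] by (simp only: \<gamma> \<gamma>_simps \<gamma>_s)
    also have "\<dots> = j (B.\<chi> x y + B.\<psi> x (\<phi> y) - B.\<psi> y (\<phi> x) + brk H (\<phi> x) (\<phi> y) - \<phi> (brk G x y))"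
      by (simp add: B.brk_coordinates B.i_simps(1,5))
    finally show ?thesis by (simp add: algebra_simps)
  qed
  moreover have "A.\<Phi> x - B.\<Phi> x = avg H (\<phi> x) - \<phi> (avg G x)" for x
  proof -
    have "j (A.\<Phi> x) = avg F (t x + j (\<phi> x)) - (t (avg G x) + j (\<phi> (avg G x)))"
      using arg_cong[OF A.i_\<Phi>, of \<gamma> x] by (simp only: \<gamma> \<gamma>_simps \<gamma>_s)
    also have "\<dots> = j (B.\<Phi> x + avg H (\<phi> x) - \<phi> (avg G x))"
      by (simp add: B.avg_coordinates B.i_simps(1,5))
    finally show ?thesis by (simp add: algebra_simps)
  qed
  ultimately show ?thesis
    using A.section_cocycle_is_cocycle B.section_cocycle_is_cocycle
    unfolding cocycle_equivalent_def A.section_cocycle_eq B.section_cocycle_eq prod.case by blast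
qed

text \<open>
  Conversely, \<open>\<phi>\<close> prescribes \<open>s x \<mapsto> t x + j (\<phi> x)\<close>, which together with \<open>i h \<mapsto> j h\<close> determines
  \<open>\<gamma>\<close>. The conditions on \<open>\<phi>\<close> are what makes the coordinates of \<open>\<gamma>\<close> at a bracket or at
  an averaged element come out right.
\<close>

lemma extension_morphism_if_cocycle_equivalent:
  assumes "cocycle_equivalent G H (section_cocycle E G i s) (section_cocycle F G j t)"
  shows "\<exists>\<gamma>. extension_morphism E i p F j q \<gamma>"
proof -
  obtain \<phi> where \<phi>: "Vector_Spaces.linear (smul G) (smul H) \<phi>"
    and \<psi>: "\<And>x h. A.\<psi> x h - B.\<psi> x h = brk H (\<phi> x) h"
    and \<chi>: "\<And>x y. A.\<chi> x y - B.\<chi> x y =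
      B.\<psi> x (\<phi> y) - B.\<psi> y (\<phi> x) - \<phi> (brk G x y) + brk H (\<phi> x) (\<phi> y)"
    and \<Phi>: "\<And>x. A.\<Phi> x - B.\<Phi> x = avg H (\<phi> x) - \<phi> (avg G x)"
    using assms
    unfolding cocycle_equivalent_def A.section_cocycle_eq B.section_cocycle_eq prod.case by blast
  note \<phi>_simps = linear_map_simps[OF \<phi>]
  define \<gamma> where "\<gamma> e = t (p e) + j (\<phi> (p e) + inv i (e - s (p e)))" for e
  have \<gamma>_coordinates: "\<gamma> (s x + i h) = t x + j (\<phi> x + h)" for x h
    by (simp add: \<gamma>_def A.p_simps A.inj_i)
  have B_\<psi>_add: "B.\<psi> x (h + k) = B.\<psi> x h + B.\<psi> x k" for x h k
    by (simp add: B.i_eq_iff[symmetric] B.i_simps B.i_\<psi> B.E.brk_simps del: B.i_eq_iff)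
  have add: "\<gamma> (d + e) = \<gamma> d + \<gamma> e" for d e
  proof -
    obtain x h where d: "d = s x + i h" by (rule A.coordinates)
    obtain y k where e: "e = s y + i k" by (rule A.coordinates)
    have "d + e = s (x + y) + i (h + k)"
      by (simp add: d e A.s_simps A.i_simps)
    then show ?thesis
      by (simp only: d e \<gamma>_coordinates) (simp add: B.s_simps B.i_simps \<phi>_simps)
  qed
  have scale: "\<gamma> (smul E c e) = smul F c (\<gamma> e)" for c e
  proof -
    obtain x h where e: "e = s x + i h" by (rule A.coordinates)
    have "smul E c e = s (smul G c x) + i (smul H c h)"
      by (simp add: e A.s_simps A.i_simps A.E.scale_right_distrib)
    then show ?thesis
      by (simp only: e \<gamma>_coordinates)
        (simp add: B.s_simps B.i_simps \<phi>_simps B.E.scale_right_distrib)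
  qed
  have brk: "\<gamma> (brk E d e) = brk F (\<gamma> d) (\<gamma> e)" for d e
  proof -
    obtain x h where d: "d = s x + i h" by (rule A.coordinates)
    obtain y k where e: "e = s y + i k" by (rule A.coordinates)
    have A\<psi>: "A.\<psi> x k = B.\<psi> x k + brk H (\<phi> x) k" "A.\<psi> y h = B.\<psi> y h + brk H (\<phi> y) h"
      using \<psi>[of x k] \<psi>[of y h] by (simp_all add: algebra_simps)
    have A\<chi>: "A.\<chi> x y = B.\<chi> x y + (B.\<psi> x (\<phi> y) - B.\<psi> y (\<phi> x) - \<phi> (brk G x y) + brk H (\<phi> x) (\<phi> y))"
      using \<chi>[of x y] by (simp add: algebra_simps)
    show ?thesis
      using A.H.brk_anticommute[of h "\<phi> y"]
      by (simp add: d e A.brk_coordinates B.brk_coordinates \<gamma>_coordinates A\<psi> A\<chi> B_\<psi>_add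
        A.H.brk_simps)
  qed
  have avg: "\<gamma> (avg E e) = avg F (\<gamma> e)" for e
  proof -
    obtain x h where e: "e = s x + i h" by (rule A.coordinates)
    have "A.\<Phi> x = B.\<Phi> x + (avg H (\<phi> x) - \<phi> (avg G x))"
      using \<Phi>[of x] by (simp add: algebra_simps)
    then show ?thesis
      by (simp add: e A.avg_coordinates B.avg_coordinates \<gamma>_coordinates A.H.avg_simps)
  qed
  have "averaging_morphism E F \<gamma>"
    using add scale brk avg
    by (auto simp: averaging_morphism_def linear_iff_add_scale A.E.vs B.E.vs)
  moreover have "\<gamma> (i h) = j h" for h
    using \<gamma>_coordinates[of 0 h] by (simp add: A.s_simps B.s_simps \<phi>_simps)
  moreover have "q (\<gamma> e) = p e" for e
    by (simp add: \<gamma>_def B.p_simps)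
  ultimately show ?thesis by (auto simp: extension_morphism_def fun_eq_iff)
qed

theorem extension_morphism_iff_cocycle_equivalent:
  "(\<exists>\<gamma>. extension_morphism E i p F j q \<gamma>) \<longleftrightarrow>
    cocycle_equivalent G H (section_cocycle E G i s) (section_cocycle F G j t)"
  using cocycle_equivalent_if_extension_morphism extension_morphism_if_cocycle_equivalent by blast

end

section \<open>Inducible pairs as morphisms from a relabelled extension\<close>

locale extension_with_automorphisms = sectioned_extension H E G i p s
  for H :: "('k::field_char_0, 'h::ab_group_add) avg_lie"
    and E :: "('k, 'e::ab_group_add) avg_lie" and G :: "('k, 'g::ab_group_add) avg_lie"
    and i :: "'h \<Rightarrow> 'e" and p :: "'e \<Rightarrow> 'g" and s :: "'g \<Rightarrow> 'e" +
  fixes \<beta> :: "'h \<Rightarrow> 'h" and \<alpha> :: "'g \<Rightarrow> 'g"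
  assumes \<beta>: "\<beta> \<in> averaging_aut H" and \<alpha>: "\<alpha> \<in> averaging_aut G"
begin

lemma \<alpha>_morphism: "averaging_morphism G G \<alpha>" and bij_\<alpha>: "bij \<alpha>" and bij_\<beta>: "bij \<beta>"
  using \<alpha> \<beta> by (auto simp: averaging_aut_def)

lemma inverse_simps [simp]:
  "\<alpha> (inv \<alpha> x) = x" "inv \<alpha> (\<alpha> x) = x" "\<beta> (inv \<beta> h) = h" "inv \<beta> (\<beta> h) = h"
  using bij_\<alpha> bij_\<beta>
  by (simp_all add: bij_is_surj surj_f_inv_f bij_is_inj)

lemma relabelled_extension: "nonabelian_extension H E G (i \<circ> inv \<beta>) (\<alpha> \<circ> p)"
proof -
  have "inj (i \<circ> inv \<beta>)" using inj_i bij_\<beta> by (simp add: inj_compose bij_imp_bij_inv bij_is_inj)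
  moreover have "range (i \<circ> inv \<beta>) = range i"
    using bij_\<beta> by (metis bij_imp_bij_inv bij_is_surj image_comp)
  moreover have "\<alpha> x = 0 \<longleftrightarrow> x = 0" for x
    using averaging_morphism_simps(3)[OF \<alpha>_morphism] inverse_simps(2) by metis
  moreover have "surj (\<alpha> \<circ> p)" using surj_p bij_is_surj[OF bij_\<alpha>] by (rule comp_surj)
  ultimately show ?thesis
    using averaging_morphism_compose[OF averaging_aut_inv[OF \<beta>] i_morphism]
      averaging_morphism_compose[OF p_morphism \<alpha>_morphism]
      H.averaging_lie_algebra E.averaging_lie_algebra G.averaging_lie_algebra range_i
    by (simp add: nonabelian_extension_def)
qed

lemma relabelled_section: "is_section E G (\<alpha> \<circ> p) (s \<circ> inv \<alpha>)"
  using Vector_Spaces.linear_compose[OF averaging_morphism_linear[OF averaging_aut_inv[OF \<alpha>]] s_linear]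
  by (simp add: is_section_def fun_eq_iff)

sublocale R: sectioned_extension H E G "i \<circ> inv \<beta>" "\<alpha> \<circ> p" "s \<circ> inv \<alpha>"
  using relabelled_extension relabelled_section by unfold_locales

text \<open>
  The bracket and operator of \<open>E\<close> are evaluated at the same lifts \<open>s (inv \<alpha> x)\<close>; reading
  their values off with \<open>i \<circ> inv \<beta>\<close> instead of \<open>i\<close> applies \<open>\<beta>\<close> to the result.
\<close>

lemma section_cocycle_relabel:
  "section_cocycle E G (i \<circ> inv \<beta>) (s \<circ> inv \<alpha>) = twisted_cocycle \<beta> \<alpha> (section_cocycle E G i s)"
proof -
  note inv_\<alpha> = averaging_morphism_simps[OF averaging_aut_inv[OF \<alpha>]]
  have eqI: "h = \<beta> k" if "(i \<circ> inv \<beta>) h = i k" for h k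
    using that by auto
  have "R.\<chi> x y = \<beta> (\<chi> (inv \<alpha> x) (inv \<alpha> y))" for x y
    by (rule eqI, subst R.i_\<chi>) (simp only: i_\<chi> o_apply inv_\<alpha>)
  moreover have "R.\<psi> x h = \<beta> (\<psi> (inv \<alpha> x) (inv \<beta> h))" for x h
    by (rule eqI, subst R.i_\<psi>) (simp only: i_\<psi> o_apply)
  moreover have "R.\<Phi> x = \<beta> (\<Phi> (inv \<alpha> x))" for x
    by (rule eqI, subst R.i_\<Phi>) (simp only: i_\<Phi> o_apply inv_\<alpha>)
  ultimately show ?thesis
    by (simp add: section_cocycle_eq R.section_cocycle_eq twisted_cocycle_def fun_eq_iff)
qed

sublocale two_sectioned_extensions H E E G "i \<circ> inv \<beta>" "\<alpha> \<circ> p" "s \<circ> inv \<alpha>" i p s ..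

text \<open>
  Knowing \<open>p \<circ> \<gamma> \<circ> s = \<alpha>\<close> for a single section already forces \<open>p \<circ> \<gamma> = \<alpha> \<circ> p\<close>, since \<open>\<gamma>\<close>
  maps \<open>range i\<close> into the kernel of \<open>p\<close>. This last equation no longer mentions sections.
\<close>

lemma inducible_iff_extension_morphism:
  "inducible E G i p \<beta> \<alpha> \<longleftrightarrow> (\<exists>\<gamma>. extension_morphism E (i \<circ> inv \<beta>) (\<alpha> \<circ> p) E i p \<gamma>)"
proof
  assume "inducible E G i p \<beta> \<alpha>"
  then obtain \<gamma> where \<gamma>: "averaging_morphism E E \<gamma>" "\<And>h. \<gamma> (i h) = i (\<beta> h)" "p \<circ> \<gamma> \<circ> s = \<alpha>"
    using "section" by (auto simp: inducible_def averaging_aut_def)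
  have "p (\<gamma> e) = \<alpha> (p e)" for e
  proof -
    obtain x h where "e = s x + i h" by (rule coordinates)
    then show ?thesis
      using fun_cong[OF \<gamma>(3), of x] by (simp add: averaging_morphism_simps[OF \<gamma>(1)] p_simps \<gamma>(2))
  qed
  then show "\<exists>\<gamma>. extension_morphism E (i \<circ> inv \<beta>) (\<alpha> \<circ> p) E i p \<gamma>"
    using \<gamma>(1,2) by (auto simp: extension_morphism_def fun_eq_iff)
next
  assume "\<exists>\<gamma>. extension_morphism E (i \<circ> inv \<beta>) (\<alpha> \<circ> p) E i p \<gamma>"
  then obtain \<gamma> where \<gamma>: "extension_morphism E (i \<circ> inv \<beta>) (\<alpha> \<circ> p) E i p \<gamma>" by blast
  have "\<gamma> (i h) = i (\<beta> h)" for h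
    using \<gamma> inverse_simps(4)[of h] by (auto simp: extension_morphism_def fun_eq_iff dest: spec[of _ "\<beta> h"])
  moreover have "p \<circ> \<gamma> \<circ> u = \<alpha>" if "is_section E G p u" for u
    using \<gamma> that by (auto simp: extension_morphism_def is_section_def fun_eq_iff)
  moreover have "\<gamma> \<in> averaging_aut E"
    using \<gamma> extension_morphism_bij by (auto simp: averaging_aut_def extension_morphism_def)
  ultimately show "inducible E G i p \<beta> \<alpha>"
    unfolding inducible_def by (intro bexI[of _ \<gamma>]) auto
qed

end

theorem theorem5p4:
  fixes H :: "('k::field_char_0, 'h::ab_group_add) avg_lie"
    and E :: "('k, 'e::ab_group_add) avg_lie"
    and G :: "('k, 'g::ab_group_add) avg_lie"
    and i :: "'h \<Rightarrow> 'e" and p :: "'e \<Rightarrow> 'g" and s :: "'g \<Rightarrow> 'e"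
    and \<beta> :: "'h \<Rightarrow> 'h" and \<alpha> :: "'g \<Rightarrow> 'g"
  assumes "nonabelian_extension H E G i p"
    and "is_section E G p s"
    and "\<beta> \<in> averaging_aut H" and "\<alpha> \<in> averaging_aut G"
  shows "inducible E G i p \<beta> \<alpha> \<longleftrightarrow>
    cocycle_equivalent G H
      (twisted_cocycle \<beta> \<alpha> (section_cocycle E G i s)) (section_cocycle E G i s)"
proof -
  interpret extension_with_automorphisms H E G i p s \<beta> \<alpha>
    using assms by unfold_locales
  show ?thesis
    using inducible_iff_extension_morphism extension_morphism_iff_cocycle_equivalent
    by (simp add: section_cocycle_relabel)
qed

end
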